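(* Let $H$ be a finite-dimensional real Hilbert space, let $\mathcal{D}$ be a symmetric dictionary in $H$, let $C=\{c_n\}_{n=1}^{\infty}$ be a sequence of positive real coefficients and let $\tau=\{t_n\}_{n=1}^{\infty}$ be a sequence of real numbers in $(0,1]$ such that (1) $\sum_{n=1}^{\infty} c_n t_n=\infty$, and (2) $\lim_{n\to\infty} \frac{c_n}{t_n}=0$. Then for every $f\in H$, all the possible greedy expansions of $f$ with prescribed coefficients $C$ and weakening sequence $\tau$ with respect to the dictionary $\mathcal{D}$ converge to $f$.
   Context: Let $H$ be a real Hilbert space with inner product $\langle\cdot,\cdot\rangle$. A set $\mathcal{D}\subset H$ is a dictionary if $\|g\|=1$ for every $g\in\mathcal{D}$ and $\overline{\operatorname{span}\,\mathcal{D}}=H$. It is symmetric if $g\in\mathcal{D}$ implies $-g\in\mathcal{D}$. Greedy expansion with prescribed coefficients. Fix a sequence $C=\{c_n\}_{n=1}^\infty$ with $c_n>0$ and a weakening sequence $\tau=\{t_n\}_{n=1}^\infty$ with $0<t_n\le 1$. For $f\in H$ put $f_0:=f$, $G_0:=0$. For $m\ge 1$, if $f_{m-1}\neq 0$, choose an element $\varphi_m\in\mathcal{D}$ such that $\langle f_{m-1},\varphi_m\rangle\ge t_m\sup_{g\in\mathcal{D}}\langle f_{m-1},g\rangle$, and set $f_m:=f_{m-1}-c_m\varphi_m$, $G_m:=G_{m-1}+c_m\varphi_m$. The series $\sum_n c_n\varphi_n$ is called a greedy expansion of $f$ (with respect to $\mathcal{D}$, with prescribed coefficients $C$ and weakening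 sequence $\tau$). If $f_{m-1}=0$ the algorithm stops; the expansion is then the finite sum $G_{m-1}=f$ and is regarded as converging to $f$. The choice of $\varphi_m$ need not be unique, so $f$ may have several greedy expansions; the claim concerns every sequence of admissible choices. A greedy expansion converges to $f$ if $\lim_{m\to\infty}G_m=f$ in norm, i.e. $\lim_{m\to\infty}\|f_m\|=0$. *)

theory Defs
  imports "HOL-Analysis.Analysis"
begin

definition dictionary :: "'a::real_inner set \<Rightarrow> bool" where
  "dictionary D \<longleftrightarrow> (\<forall>g\<in>D. norm g = 1) \<and> closure (span D) = UNIV"

definition symmetric_dictionary :: "'a::real_inner set \<Rightarrow> bool" where
  "symmetric_dictionary D \<longleftrightarrow> dictionary D \<and> (\<forall>g\<in>D. - g \<in> D)"

definition finite_dimensional :: "'a::real_vector itself \<Rightarrow> bool" where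
  "finite_dimensional _ \<longleftrightarrow> (\<exists>B::'a set. finite B \<and> span B = UNIV)"

text \<open>
  The sequences of coefficients, weakening parameters and chosen elements are indexed
  from 1; their values at 0 are never used. Once a residual is zero the algorithm
  has stopped: residual and approximant then stay constant, and later values of the
  sequence \<open>\<phi>\<close> are irrelevant.
\<close>

primrec residual :: "(nat \<Rightarrow> real) \<Rightarrow> (nat \<Rightarrow> 'a::real_inner) \<Rightarrow> 'a \<Rightarrow> nat \<Rightarrow> 'a" where
  "residual c \<phi> f 0 = f"
| "residual c \<phi> f (Suc m) =
     (if residual c \<phi> f m = 0 then residual c \<phi> f m
      else residual c \<phi> f m - c (Suc m) *\<^sub>R \<phi> (Suc m))"

primrec approximant :: "(nat \<Rightarrow> real) \<Rightarrow> (nat \<Rightarrow> 'a::real_inner) \<Rightarrow> 'a \<Rightarrow> nat \<Rightarrow> 'a" where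
  "approximant c \<phi> f 0 = 0"
| "approximant c \<phi> f (Suc m) =
     (if residual c \<phi> f m = 0 then approximant c \<phi> f m
      else approximant c \<phi> f m + c (Suc m) *\<^sub>R \<phi> (Suc m))"

text \<open>
  The supremum below is that of a set of reals, and it is a genuine one for a dictionary
  \<open>D\<close>: the set is bounded by the norm of the residual, and it is nonempty because a
  nonzero residual exists only if \<open>D\<close> is nonempty.
\<close>

definition greedy_expansion ::
  "'a::real_inner set \<Rightarrow> (nat \<Rightarrow> real) \<Rightarrow> (nat \<Rightarrow> real) \<Rightarrow> 'a \<Rightarrow> (nat \<Rightarrow> 'a) \<Rightarrow> bool" where
  "greedy_expansion D c t f \<phi> \<longleftrightarrow>
     (\<forall>m\<ge>1. residual c \<phi> f (m - 1) \<noteq> 0 \<longrightarrow>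
        \<phi> m \<in> D \<and>
        inner (residual c \<phi> f (m - 1)) (\<phi> m)
          \<ge> t m * (SUP g\<in>D. inner (residual c \<phi> f (m - 1)) g))"

definition expansion_converges :: "(nat \<Rightarrow> real) \<Rightarrow> (nat \<Rightarrow> 'a::real_inner) \<Rightarrow> 'a \<Rightarrow> bool" where
  "expansion_converges c \<phi> f \<longleftrightarrow> approximant c \<phi> f \<longlonglongrightarrow> f"

end

theory Submission imports Defs begin

text \<open>
  In finite dimension the support function of a symmetric dictionary is bounded below by
  \<open>\<beta> * norm x\<close> for some \<open>\<beta> > 0\<close>. Hence, with \<open>a = c t\<close> and \<open>e = c / t\<close>, one step changes the
  squared norm of the residual \<open>r\<close> by at most \<open>c\<^sup>2 - 2 c t \<beta> norm r = - a (2 \<beta> norm r - e)\<close>.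
  As \<open>e\<close> tends to \<open>0\<close> and the sum of \<open>a\<close> diverges, the norm cannot stay above any given
  level, and once below that level it can overshoot it by at most \<open>e\<close>.
\<close>

text \<open>\<open>K\<close> is the sum of the absolute values of the coefficients in a
  representation of \<open>d\<close>. It depends on \<open>d\<close> alone, so one constant serves
  all \<open>x\<close> and \<open>s\<close>.\<close>

lemma abs_inner_span_bound:
  fixes D :: "'a::real_inner set"
  assumes "d \<in> span D"
  shows "\<exists>K\<ge>0. \<forall>x s. (\<forall>g\<in>D. \<bar>inner x g\<bar> \<le> s) \<longrightarrow> \<bar>inner x d\<bar> \<le> K * s"
  using assms
proof (induction rule: span_induct_alt)
  case base
  then show ?case by (intro exI[of _ 0]) auto
next
  case (step u g d)
  then obtain K where K: "K \<ge> 0" "\<And>x s. (\<forall>g\<in>D. \<bar>inner x g\<bar> \<le> s) \<Longrightarrow> \<bar>inner x d\<bar> \<le> K * s"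
    by blast
  have "\<bar>inner x (u *\<^sub>R g + d)\<bar> \<le> (\<bar>u\<bar> + K) * s" if "\<forall>g\<in>D. \<bar>inner x g\<bar> \<le> s" for x s
  proof -
    have "\<bar>inner x (u *\<^sub>R g + d)\<bar> \<le> \<bar>u\<bar> * \<bar>inner x g\<bar> + \<bar>inner x d\<bar>"
      by (metis abs_mult abs_triangle_ineq inner_add_right inner_scaleR_right)
    also have "\<dots> \<le> \<bar>u\<bar> * s + K * s"
      using that \<open>g \<in> D\<close> K by (intro add_mono mult_left_mono) auto
    finally show ?thesis by (simp add: distrib_right)
  qed
  with K show ?case by (intro exI[of _ "\<bar>u\<bar> + K"]) auto
qed

text \<open>The difference \<open>z\<close> of the two sides lies in \<open>span B\<close> and is
  orthogonal to \<open>B\<close>, hence to itself. Normalising by \<open>sgn\<close> lets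
  \<open>B\<close> contain zero, whose term vanishes because \<open>sgn 0 = 0\<close>.\<close>

lemma orthogonal_expansion:
  fixes B :: "'a::real_inner set"
  assumes "finite B" "pairwise orthogonal B" "x \<in> span B"
  shows "x = (\<Sum>b\<in>B. inner x (sgn b) *\<^sub>R sgn b)"
proof -
  define z where "z = x - (\<Sum>b\<in>B. inner x (sgn b) *\<^sub>R sgn b)"
  have "orthogonal z b" if "b \<in> B" for b
  proof -
    \<comment> \<open>Pairwise orthogonality leaves only the term for \<open>b\<close>
      itself.\<close>
    have "(\<Sum>a\<in>B. inner x (sgn a) * inner (sgn a) b) = (\<Sum>a\<in>{b}. inner x (sgn a) * inner (sgn a) b)"
      using assms that
      by (intro sum.mono_neutral_right) (auto simp: pairwise_def orthogonal_def sgn_div_norm)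
    also have "\<dots> = inner x b"
      by (cases "b = 0") (simp_all add: sgn_div_norm power2_eq_square field_simps flip: power2_norm_eq_inner)
    finally show ?thesis
      by (simp add: z_def orthogonal_def inner_diff_left inner_sum_left)
  qed
  moreover have "z \<in> span B"
    unfolding z_def sgn_div_norm using assms(3)
    by (intro span_diff span_sum span_scale) (auto intro: span_base)
  ultimately have "orthogonal z z"
    using orthogonal_to_span by blast
  then show ?thesis
    by (simp add: z_def orthogonal_def)
qed

text \<open>Each normalised vector of an orthogonal basis is approximated by an element of
  \<open>span D\<close>, on which the inner product with \<open>x\<close> is controlled by
  \<open>s\<close>. The errors together amount to at most half of \<open>norm x\<close> and are
  absorbed on the left.\<close>

lemma finite_dimensional_norm_bound:
  fixes D :: "'a::real_inner set"
  assumes "finite_dimensional TYPE('a)" "closure (span D) = UNIV"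
  obtains K where "K > 0" "\<And>x s. s \<ge> 0 \<Longrightarrow> (\<And>g. g \<in> D \<Longrightarrow> \<bar>inner x g\<bar> \<le> s) \<Longrightarrow> norm x \<le> K * s"
proof -
  obtain A :: "'a set" where "finite A" "span A = UNIV"
    using assms(1) by (auto simp: finite_dimensional_def)
  with basis_orthogonal[of A] obtain B :: "'a set"
    where B: "finite B" "span B = UNIV" "pairwise orthogonal B" by auto
  \<comment> \<open>Chosen so that \<open>card B * \<delta> \<le> 1 / 2\<close>; the added 1 keeps
    \<open>\<delta>\<close> positive even for empty \<open>B\<close>.\<close>
  define \<delta> where "\<delta> = 1 / (2 * (real (card B) + 1))"
  have "\<delta> > 0" by (simp add: \<delta>_def)
  have "\<exists>d\<in>span D. dist d (sgn b) < \<delta>" for b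
    using assms(2) \<open>\<delta> > 0\<close> by (metis UNIV_I closure_approachable)
  then obtain d where d: "\<And>b. d b \<in> span D" "\<And>b. norm (sgn b - d b) < \<delta>"
    by (metis dist_commute dist_norm)
  from abs_inner_span_bound[OF d(1)] obtain k where k: "\<And>b. k b \<ge> 0"
    "\<And>b x s. (\<forall>g\<in>D. \<bar>inner x g\<bar> \<le> s) \<Longrightarrow> \<bar>inner x (d b)\<bar> \<le> k b * s"
    by metis
  have bound: "norm x \<le> (2 * sum k B) * s" if s: "\<forall>g\<in>D. \<bar>inner x g\<bar> \<le> s" for x s
  proof -
    have "norm x = norm (\<Sum>b\<in>B. inner x (sgn b) *\<^sub>R sgn b)"
      using orthogonal_expansion[of B x] B by simp
    also have "\<dots> \<le> (\<Sum>b\<in>B. k b * s + norm x * \<delta>)"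
    proof (rule sum_norm_le)
      fix b
      have "norm (inner x (sgn b) *\<^sub>R sgn b) \<le> \<bar>inner x (sgn b)\<bar>"
        by (simp add: norm_sgn)
      also have "\<dots> = \<bar>inner x (d b) + inner x (sgn b - d b)\<bar>"
        by (simp add: inner_diff_right)
      also have "\<dots> \<le> \<bar>inner x (d b)\<bar> + norm x * norm (sgn b - d b)"
        using Cauchy_Schwarz_ineq2[of x "sgn b - d b"] by linarith
      also have "\<dots> \<le> k b * s + norm x * \<delta>"
        using k(2)[OF s] d(2)[of b] by (intro add_mono mult_left_mono) auto
      finally show "norm (inner x (sgn b) *\<^sub>R sgn b) \<le> k b * s + norm x * \<delta>" .
    qed
    also have "\<dots> = sum k B * s + norm x * (card B * \<delta>)"
      by (simp add: sum.distrib sum_distrib_right)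
    also have "\<dots> \<le> sum k B * s + norm x * (1 / 2)"
      by (intro add_left_mono mult_left_mono) (auto simp: \<delta>_def field_simps)
    finally show ?thesis by simp
  qed
  show thesis
  proof (rule that)
    \<comment> \<open>The sum may be zero, so 1 is added to get a positive constant; the extra
      summand \<open>s\<close> is harmless as \<open>s \<ge> 0\<close>.\<close>
    show "2 * sum k B + 1 > 0"
      using k(1) by (simp add: sum_nonneg add_nonneg_pos)
    fix x s
    assume "s \<ge> 0" "\<And>g. g \<in> D \<Longrightarrow> \<bar>inner x g\<bar> \<le> s"
    then show "norm x \<le> (2 * sum k B + 1) * s"
      using bound[of x s] by (simp add: distrib_right)
  qed
qed

text \<open>The scalar core of the argument, to be applied with \<open>y\<close> the norm of the
  residual. The condition \<open>a n \<le> e n\<close> limits the growth in one step, since the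
  square then gains at most \<open>a n * e n \<le> e n * e n\<close>.\<close>

lemma tendsto_zero_of_square_descent:
  fixes y a e :: "nat \<Rightarrow> real"
  assumes "\<beta> > 0"
    and y: "\<And>n. y n \<ge> 0"
    and a: "\<And>n. 0 \<le> a n" "\<And>n. a n \<le> e n"
    and a_div: "filterlim (\<lambda>N. \<Sum>n<N. a n) at_top sequentially"
    and e: "e \<longlonglongrightarrow> 0"
    and step: "\<And>n. (y (Suc n))\<^sup>2 \<le> (y n)\<^sup>2 - a n * (2 * \<beta> * y n - e n)"
  shows "y \<longlonglongrightarrow> 0"
proof (rule LIMSEQ_I)
  fix r :: real
  assume "r > 0"
  \<comment> \<open>Half of the tolerance is the level to be reached, the other half is left for an
    overshoot.\<close>
  define \<epsilon> where "\<epsilon> = r / 2"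
  have "\<epsilon> > 0" using \<open>r > 0\<close> by (simp add: \<epsilon>_def)
  have "\<forall>\<^sub>F n in sequentially. e n < \<beta> * \<epsilon> \<and> e n < \<epsilon>"
    using e \<open>\<epsilon> > 0\<close> \<open>\<beta> > 0\<close> by (intro eventually_conj order_tendstoD(2)) auto
  \<comment> \<open>The first bound keeps half of the decrease \<open>2 * \<beta> * y n\<close> when
    \<open>y n \<ge> \<epsilon>\<close>; the second keeps an overshoot below
    \<open>\<epsilon>\<close>.\<close>
  then obtain N where N: "\<And>n. n \<ge> N \<Longrightarrow> e n < \<beta> * \<epsilon>" "\<And>n. n \<ge> N \<Longrightarrow> e n < \<epsilon>"
    by (auto simp: eventually_sequentially)
  have descent: "(y (Suc n))\<^sup>2 \<le> (y n)\<^sup>2 - \<beta> * \<epsilon> * a n" if "n \<ge> N" "y n \<ge> \<epsilon>" for n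
  proof -
    have "\<beta> * \<epsilon> \<le> \<beta> * y n" using that \<open>\<beta> > 0\<close> by simp
    then have "\<beta> * \<epsilon> \<le> 2 * \<beta> * y n - e n" using N(1)[OF that(1)] by linarith
    from mult_left_mono[OF this a(1)[of n]] show ?thesis
      using step[of n] by (simp add: mult.commute)
  qed
  have overshoot: "y (Suc n) \<le> y n + e n" for n
  proof (rule power2_le_imp_le)
    have "e n \<ge> 0" using a order_trans by blast
    then have "a n * e n \<le> e n * e n" "0 \<le> 2 * \<beta> * a n * y n" "0 \<le> 2 * y n * e n"
      using a[of n] y[of n] \<open>\<beta> > 0\<close> by (auto intro: mult_right_mono)
    then show "(y (Suc n))\<^sup>2 \<le> (y n + e n)\<^sup>2"
      using step[of n] by (simp add: algebra_simps power2_eq_square)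
    show "0 \<le> y n + e n" using \<open>e n \<ge> 0\<close> y[of n] by simp
  qed
  have "\<exists>M\<ge>N. y M < \<epsilon>"
  proof (rule ccontr)
    assume "\<not> (\<exists>M\<ge>N. y M < \<epsilon>)"
    then have large: "y n \<ge> \<epsilon>" if "n \<ge> N" for n using that by force
    have sum_bound: "\<beta> * \<epsilon> * (\<Sum>n<m. a n) \<le> (y N)\<^sup>2 - (y m)\<^sup>2 + \<beta> * \<epsilon> * (\<Sum>n<N. a n)" if "m \<ge> N" for m
      using that
    proof (induction m rule: dec_induct)
      case (step m)
      then show ?case using descent[OF step(1) large[OF step(1)]] by (simp add: distrib_left)
    qed simp
    \<comment> \<open>Dropping \<open>(y m)^2\<close> in \<open>sum_bound\<close> shows that
      \<open>L\<close> bounds all partial sums of \<open>a\<close> with at least \<open>N\<close>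
      terms, which contradicts divergence.\<close>
    define L where "L = ((y N)\<^sup>2 + \<beta> * \<epsilon> * (\<Sum>n<N. a n)) / (\<beta> * \<epsilon>)"
    have "\<forall>\<^sub>F m in sequentially. L < (\<Sum>n<m. a n) \<and> m \<ge> N"
      using a_div by (intro eventually_conj eventually_ge_at_top) (auto simp: filterlim_at_top_dense)
    then obtain m where m: "L < (\<Sum>n<m. a n)" "m \<ge> N"
      by (auto dest: eventually_happens)
    have "L \<ge> (\<Sum>n<m. a n)"
      unfolding L_def using sum_bound[OF m(2)] \<open>\<epsilon> > 0\<close> \<open>\<beta> > 0\<close> 
      by (simp add: pos_le_divide_eq mult.commute) (smt (verit) zero_le_power2)
    with m show False by simp
  qed
  then obtain M where M: "M \<ge> N" "y M < \<epsilon>" by blast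
  \<comment> \<open>Invariant: from below \<open>\<epsilon>\<close> a step leads at most to
    \<open>\<epsilon> + e n < r\<close>, and from \<open>\<epsilon>\<close> or above it does not
    increase \<open>y\<close>.\<close>
  have "y n < r" if "n \<ge> M" for n
    using that
  proof (induction n rule: dec_induct)
    case base
    then show ?case using M \<open>r > 0\<close> by (simp add: \<epsilon>_def)
  next
    case (step n)
    have "n \<ge> N" using M step by simp
    show ?case
    proof (cases "y n < \<epsilon>")
      case True
      then show ?thesis using overshoot[of n] N(2)[OF \<open>n \<ge> N\<close>] by (simp add: \<epsilon>_def)
    next
      case False
      have "0 \<le> \<beta> * \<epsilon> * a n" using a(1) \<open>\<epsilon> > 0\<close> \<open>\<beta> > 0\<close> by simp
      then have "(y (Suc n))\<^sup>2 \<le> (y n)\<^sup>2"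
        using descent[OF \<open>n \<ge> N\<close>] False by force
      then have "y (Suc n) \<le> y n" using y power2_le_imp_le by blast
      then show ?thesis using step by simp
    qed
  qed
  then show "\<exists>no. \<forall>n\<ge>no. norm (y n - 0) < r" using y by auto
qed

lemma approximant_add_residual: "approximant c \<phi> f m + residual c \<phi> f m = f"
proof (induction m)
  case (Suc m)
  then show ?case by (cases "residual c \<phi> f m = 0") simp_all
qed simp

text \<open>Expand the square of the new residual, using that the chosen element has norm 1; the
  greedy choice and the bound on the supremum control the cross term. The factored form matches the
  scalar recursion.\<close>

lemma residual_norm_descent:
  fixes D :: "'a::real_inner set"
  assumes greedy: "greedy_expansion D c t f \<phi>"
    and D: "\<And>g. g \<in> D \<Longrightarrow> norm g = 1"
    and sup: "\<And>x. x \<noteq> 0 \<Longrightarrow> \<beta> * norm x \<le> (SUP g\<in>D. inner x g)"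
    and c: "c (Suc m) > 0" and t: "t (Suc m) > 0"
  shows "(norm (residual c \<phi> f (Suc m)))\<^sup>2 \<le> (norm (residual c \<phi> f m))\<^sup>2
    - c (Suc m) * t (Suc m) * (2 * \<beta> * norm (residual c \<phi> f m) - c (Suc m) / t (Suc m))"
proof (cases "residual c \<phi> f m = 0")
  case True
  \<comment> \<open>After stopping, the residual stays zero and the claim reduces to
    \<open>0 \<le> (c (Suc m))^2\<close>.\<close>
  then show ?thesis using c t by simp
next
  case False
  define r where "r = residual c \<phi> f m"
  define n where "n = Suc m"
  have in_D: "\<phi> n \<in> D" and "inner r (\<phi> n) \<ge> t n * (SUP g\<in>D. inner r g)"
    using greedy[unfolded greedy_expansion_def, rule_format, of n] False
    by (auto simp: n_def r_def)
  moreover have "t n * (\<beta> * norm r) \<le> t n * (SUP g\<in>D. inner r g)"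
    using sup[of r] t False by (intro mult_left_mono) (auto simp: n_def r_def)
  ultimately have "c n * (t n * (\<beta> * norm r)) \<le> c n * inner r (\<phi> n)"
    using c by (intro mult_left_mono) (auto simp: n_def)
  moreover have "(norm (r - c n *\<^sub>R \<phi> n))\<^sup>2 = (norm r)\<^sup>2 - 2 * (c n * inner r (\<phi> n)) + (c n)\<^sup>2"
    using D[OF in_D] unfolding norm_eq_1 power2_norm_eq_inner
    by (simp add: inner_diff_left inner_diff_right inner_commute power2_eq_square)
  moreover have "c n * t n * (2 * \<beta> * norm r - c n / t n)
      = 2 * (c n * (t n * (\<beta> * norm r))) - (c n)\<^sup>2"
    using t by (simp add: n_def power2_eq_square field_simps)
  ultimately have "(norm (r - c n *\<^sub>R \<phi> n))\<^sup>2 \<le> (norm r)\<^sup>2 - c n * t n * (2 * \<beta> * norm r - c n / t n)"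
    by linarith
  then show ?thesis using False by (simp add: r_def n_def)
qed

text \<open>By symmetry the supremum also dominates \<open>- inner x g\<close>, hence all absolute
  values, so the norm bound applies and \<open>\<beta> = 1 / K\<close> works.\<close>

lemma symmetric_dictionary_sup_bound:
  fixes D :: "'a::real_inner set"
  assumes "finite_dimensional TYPE('a)" "symmetric_dictionary D"
  obtains \<beta> where "\<beta> > 0" "\<And>x. x \<noteq> 0 \<Longrightarrow> \<beta> * norm x \<le> (SUP g\<in>D. inner x g)"
proof -
  have D: "\<And>g. g \<in> D \<Longrightarrow> norm g = 1" "closure (span D) = UNIV" "\<And>g. g \<in> D \<Longrightarrow> - g \<in> D"
    using assms(2) by (auto simp: symmetric_dictionary_def dictionary_def)
  obtain K where K: "K > 0" "\<And>x s. s \<ge> 0 \<Longrightarrow> (\<And>g. g \<in> D \<Longrightarrow> \<bar>inner x g\<bar> \<le> s) \<Longrightarrow> norm x \<le> K * s"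
    using finite_dimensional_norm_bound[OF assms(1) D(2)] by blast
  show thesis
  proof (rule that)
    show "1 / K > 0" using K by simp
    fix x :: 'a
    assume "x \<noteq> 0"
    have "bdd_above ((\<lambda>g. inner x g) ` D)"
      using D(1) norm_cauchy_schwarz[of x] by (intro bdd_aboveI2[of _ _ "norm x"]) (metis mult.right_neutral)
    then have le: "inner x g \<le> (SUP g\<in>D. inner x g)" if "g \<in> D" for g
      using that by (rule cSUP_upper2) auto
    have "\<bar>inner x g\<bar> \<le> (SUP g\<in>D. inner x g)" if "g \<in> D" for g
      using le[OF that] le[OF D(3)[OF that]] by (simp add: abs_le_iff)
    \<comment> \<open>For empty \<open>D\<close> the bound with \<open>s = 0\<close> would force
      \<open>x = 0\<close>. An element of \<open>D\<close> is what makes the supremum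
      nonnegative.\<close>
    moreover obtain g where "g \<in> D"
      using K(2)[of 0 x] \<open>x \<noteq> 0\<close> by force
    ultimately have "norm x \<le> K * (SUP g\<in>D. inner x g)"
      by (intro K(2)) (auto intro: order_trans[OF abs_ge_zero])
    then show "1 / K * norm x \<le> (SUP g\<in>D. inner x g)"
      using K(1) by (simp add: field_simps)
  qed
qed

theorem theorem2p1:
  fixes D :: "'a::{real_inner, complete_space} set"
    and c t :: "nat \<Rightarrow> real"
  assumes "finite_dimensional TYPE('a)"
    and "symmetric_dictionary D"
    and "\<And>n. n \<ge> 1 \<Longrightarrow> c n > 0"
    and "\<And>n. n \<ge> 1 \<Longrightarrow> 0 < t n \<and> t n \<le> 1"
    and "filterlim (\<lambda>N. \<Sum>n=1..N. c n * t n) at_top sequentially"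
    and "(\<lambda>n. c n / t n) \<longlonglongrightarrow> 0"
  shows "\<forall>f \<phi>. greedy_expansion D c t f \<phi> \<longrightarrow> expansion_converges c \<phi> f"
proof (intro allI impI)
  fix f \<phi>
  assume greedy: "greedy_expansion D c t f \<phi>"
  have D: "\<And>g. g \<in> D \<Longrightarrow> norm g = 1"
    using assms(2) by (auto simp: symmetric_dictionary_def dictionary_def)
  obtain \<beta> where \<beta>: "\<beta> > 0" "\<And>x. x \<noteq> 0 \<Longrightarrow> \<beta> * norm x \<le> (SUP g\<in>D. inner x g)"
    using symmetric_dictionary_sup_bound[OF assms(1,2)] by blast
  have "(\<lambda>m. norm (residual c \<phi> f m)) \<longlonglongrightarrow> 0"
  proof (rule tendsto_zero_of_square_descent[OF \<beta>(1)])
    \<comment> \<open>The residual with index \<open>m\<close> is the one before step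
      \<open>Suc m\<close>, so all coefficients are shifted by one.\<close>
    fix m
    have ct: "c (Suc m) > 0" "t (Suc m) > 0" "t (Suc m) \<le> 1"
      using assms(3,4)[of "Suc m"] by auto
    then show "0 \<le> c (Suc m) * t (Suc m)" by simp
    \<comment> \<open>Here \<open>t \<le> 1\<close> enters: it gives
      \<open>c * t \<le> c / t\<close>.\<close>
    have "t (Suc m) * t (Suc m) \<le> 1" using ct by (simp add: mult_le_one)
    then show "c (Suc m) * t (Suc m) \<le> c (Suc m) / t (Suc m)"
      using ct by (simp add: pos_le_divide_eq mult.assoc)
    show "(norm (residual c \<phi> f (Suc m)))\<^sup>2 \<le> (norm (residual c \<phi> f m))\<^sup>2
        - c (Suc m) * t (Suc m) * (2 * \<beta> * norm (residual c \<phi> f m) - c (Suc m) / t (Suc m))"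
      using residual_norm_descent[OF greedy D \<beta>(2)] ct by blast
  next
    have "(\<Sum>n=1..N. c n * t n) = (\<Sum>m<N. c (Suc m) * t (Suc m))" for N
      by (rule sum.reindex_bij_witness[of _ Suc "\<lambda>n. n - 1"]) auto
    with assms(5) show "filterlim (\<lambda>N. \<Sum>m<N. c (Suc m) * t (Suc m)) at_top sequentially" by simp
    show "(\<lambda>m. c (Suc m) / t (Suc m)) \<longlonglongrightarrow> 0"
      using assms(6) by (rule LIMSEQ_Suc)
  qed simp
  then have "(\<lambda>m. f - residual c \<phi> f m) \<longlonglongrightarrow> f - 0"
    by (rule tendsto_diff[OF tendsto_const tendsto_norm_zero_cancel])
  moreover have "f - residual c \<phi> f m = approximant c \<phi> f m" for m
    using approximant_add_residual[of c \<phi> f m] by (simp add: diff_eq_eq)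
  ultimately show "expansion_converges c \<phi> f"
    by (simp add: expansion_converges_def)
qed

end
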